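(* Let $(U,\{\mathcal H_n\}_{n\in\mathbb Z})$ be a translation-invariant one-dimensional quantum walk. For each $k=1,2,3,4$ there exists a translation-invariant one-dimensional quantum walk in the class $\mathcal C_k$ that is unitary equivalent to $(U,\{\mathcal H_n\}_{n\in\mathbb Z})$.
   Context: A quantum walk is a pair $(U,\{\mathcal H_v\}_{v\in V})$ where $V$ is a countable set, $\{\mathcal H_v\}_{v\in V}$ is a family of separable Hilbert spaces, and $U$ is a unitary operator on $\mathcal H=\bigoplus_{v\in V}\mathcal H_v$. $P_v$ is the orthogonal projection of $\mathcal H$ onto $\mathcal H_v$ and $U_{uv}=U_{u,v}=P_uUP_v$, also regarded as an operator between the summands $\mathcal H_v$ and $\mathcal H_u$. The graph $(V,D)$ of the walk is the directed (multi)graph in which the number of directed edges from $v$ to $u$ is $\mathrm{card}(u,v)=\operatorname{rank}U_{uv}$. A quantum walk is one-dimensional if $V=\mathbb Z$, $\dim\mathcal H_n=2$ for all $n$, and its graph has edge set $D=\{(n,n+1),(n+1,n):n\in\mathbb Z\}$ with $\mathrm{card}(n,n+1)=\mathrm{card}(n+1,n)=1$ for all $n$ (so $U_{m,n}$ has rank $1$ if $|m-n|=1$ and is $0$ otherwise). A one-dimensional quantum walk is translation invariant if $\mathcal H_n=\mathcal H_{n+1}$ for all $n\in\mathbb Z$ (all summands are the same Hilbert space) and $U_{m,n}=U_{m+1,n+1}$ (as operators $\mathcal H_n\to\mathcal H_m$ and $\mathcal H_{n+1}\to\mathcal H_{m+1}$ on this common space) for all $m,n\in\mathbb Z$. Two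 quantum walks $(U_1,\{\mathcal H^{(1)}_{v}\}_{v\in V_1})$ and $(U_2,\{\mathcal H^{(2)}_{v}\}_{v\in V_2})$ are unitary equivalent if there are a unitary $W:\bigoplus_{v\in V_1}\mathcal H^{(1)}_v\to\bigoplus_{v\in V_2}\mathcal H^{(2)}_v$ and a bijection $\phi:V_1\to V_2$ with $W\mathcal H^{(1)}_{v}=\mathcal H^{(2)}_{\phi(v)}$ for all $v\in V_1$ and $WU_1W^*=U_2$. The classes $\mathcal C_1,\dots,\mathcal C_4$ consist of one-dimensional quantum walks with $\mathcal H_n=\mathbb C^2$ for all $n$. For a $2\times2$ matrix $A$, $|m\rangle\langle n|\otimes A$ denotes the operator that sends $\xi\in\mathcal H_n=\mathbb C^2$ to $A\xi\in\mathcal H_m=\mathbb C^2$ and vanishes on $\mathcal H_l$ for $l\ne n$. A one-dimensional quantum walk (in particular $U$ is unitary) with $\mathcal H_n=\mathbb C^2$ belongs to $\mathcal C_k$ if there are complex numbers $a_n,b_n,c_n,d_n$ ($n\in\mathbb Z$) such that for all $n\in\mathbb Z$: $\mathcal C_1$: $U_{n-1,n}=|n-1\rangle\langle n|\otimes\begin{bmatrix}a_n&b_n\\0&0\end{bmatrix}$, $U_{n+1,n}=|n+1\rangle\langle n|\otimes\begin{bmatrix}0&0\\c_n&d_n\end{bmatrix}$; $\mathcal C_2$: $U_{n-1,n}=|n-1\rangle\langle n|\otimes\begin{bmatrix}a_n&0\\c_n&0\end{bmatrix}$, $U_{n+1,n}=|n+1\rangle\langle n|\otimes\begin{bmatrix}0&b_n\\0&d_n\end{bmatrix}$;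 $\mathcal C_3$: $U_{n-1,n}=|n-1\rangle\langle n|\otimes\begin{bmatrix}0&0\\c_n&d_n\end{bmatrix}$, $U_{n+1,n}=|n+1\rangle\langle n|\otimes\begin{bmatrix}a_n&b_n\\0&0\end{bmatrix}$; $\mathcal C_4$: $U_{n-1,n}=|n-1\rangle\langle n|\otimes\begin{bmatrix}0&b_n\\0&d_n\end{bmatrix}$, $U_{n+1,n}=|n+1\rangle\langle n|\otimes\begin{bmatrix}a_n&0\\c_n&0\end{bmatrix}$. *)

theory Defs
  imports "HOL-Analysis.Analysis"
begin

section \<open>Complex inner product spaces\<close>

text \<open>
  The inner product is antilinear in the first argument. Positive definiteness is contained in
  \<open>cinner_self\<close>. Completeness is not part of the class: it is required of the individual
  summands of a quantum walk.
\<close>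

class complex_inner = real_normed_vector +
  fixes scaleC :: "complex \<Rightarrow> 'a \<Rightarrow> 'a"  (infixr \<open>*\<^sub>C\<close> 75)
    and cinner :: "'a \<Rightarrow> 'a \<Rightarrow> complex"
  assumes scaleC_add_right: "a *\<^sub>C (x + y) = a *\<^sub>C x + a *\<^sub>C y"
    and scaleC_add_left: "(a + b) *\<^sub>C x = a *\<^sub>C x + b *\<^sub>C x"
    and scaleC_scaleC: "a *\<^sub>C b *\<^sub>C x = (a * b) *\<^sub>C x"
    and scaleC_one: "1 *\<^sub>C x = x"
    and scaleC_of_real: "of_real r *\<^sub>C x = r *\<^sub>R x"
    and cinner_commute: "cinner x y = cnj (cinner y x)"
    and cinner_add_right: "cinner x (y + z) = cinner x y + cinner x z"
    and cinner_scaleC_right: "cinner x (a *\<^sub>C y) = a * cinner x y"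
    and cinner_self: "cinner x x = of_real ((norm x)\<^sup>2)"

global_interpretation complex_vector: vector_space "scaleC :: complex \<Rightarrow> 'a \<Rightarrow> 'a::complex_inner"
  by unfold_locales (simp_all add: scaleC_add_right scaleC_add_left scaleC_scaleC scaleC_one)

instantiation complex :: complex_inner
begin

definition scaleC_complex :: "complex \<Rightarrow> complex \<Rightarrow> complex"
  where "scaleC_complex a x = a * x"

definition cinner_complex :: "complex \<Rightarrow> complex \<Rightarrow> complex"
  where "cinner_complex x y = cnj x * y"

instance
proof
  fix x y z a b :: complex and r :: real
  show "a *\<^sub>C (x + y) = a *\<^sub>C x + a *\<^sub>C y" "(a + b) *\<^sub>C x = a *\<^sub>C x + b *\<^sub>C x"
    "a *\<^sub>C b *\<^sub>C x = (a * b) *\<^sub>C x" "1 *\<^sub>C x = x" "of_real r *\<^sub>C x = r *\<^sub>R x"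
    by (simp_all add: scaleC_complex_def distrib_left distrib_right mult.assoc scaleR_conv_of_real)
  show "cinner x y = cnj (cinner y x)" "cinner x (y + z) = cinner x y + cinner x z"
    "cinner x (a *\<^sub>C y) = a * cinner x y"
    by (simp_all add: cinner_complex_def scaleC_complex_def distrib_left)
  show "cinner x x = of_real ((norm x)\<^sup>2)"
    unfolding cinner_complex_def complex_norm_square by (rule mult.commute)
qed

end

instantiation vec :: (complex_inner, finite) complex_inner
begin

definition scaleC_vec :: "complex \<Rightarrow> 'a ^ 'b \<Rightarrow> 'a ^ 'b"
  where "scaleC_vec a x = (\<chi> i. a *\<^sub>C (x $ i))"

definition cinner_vec :: "'a ^ 'b \<Rightarrow> 'a ^ 'b \<Rightarrow> complex"
  where "cinner_vec x y = (\<Sum>i\<in>UNIV. cinner (x $ i) (y $ i))"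

instance
proof
  fix x y z :: "'a ^ 'b" and a b :: complex and r :: real
  show "a *\<^sub>C (x + y) = a *\<^sub>C x + a *\<^sub>C y" "(a + b) *\<^sub>C x = a *\<^sub>C x + b *\<^sub>C x"
    "a *\<^sub>C b *\<^sub>C x = (a * b) *\<^sub>C x" "1 *\<^sub>C x = x" "of_real r *\<^sub>C x = r *\<^sub>R x"
    by (simp_all add: scaleC_vec_def vec_eq_iff scaleC_add_right scaleC_add_left scaleC_scaleC
        scaleC_one scaleC_of_real)
  show "cinner x y = cnj (cinner y x)"
    unfolding cinner_vec_def cnj_sum by (intro sum.cong refl cinner_commute)
  show "cinner x (y + z) = cinner x y + cinner x z"
    by (simp add: cinner_vec_def cinner_add_right sum.distrib)
  show "cinner x (a *\<^sub>C y) = a * cinner x y"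
    by (simp add: cinner_vec_def scaleC_vec_def cinner_scaleC_right sum_distrib_left)
  show "cinner x x = of_real ((norm x)\<^sup>2)"
    unfolding cinner_vec_def cinner_self norm_vec_def L2_set_def
    by (subst real_sqrt_pow2) (simp_all add: sum_nonneg)
qed

end


section \<open>Hilbert space direct sums\<close>

text \<open>
  A family of Hilbert spaces is given by complete complex subspaces \<open>H v\<close> of one ambient complex
  inner product space. The ambient space only provides the operations: the summands are
  arbitrary, and they may overlap or coincide, because the direct sum is the external one.
  An element of the direct sum is a square summable section, extended by \<open>0\<close> outside the
  index set.
\<close>

definition hilbert_subspace :: "'a::complex_inner set \<Rightarrow> bool"
  where "hilbert_subspace S \<longleftrightarrow> complex_vector.subspace S \<and> complete S"

definition dsum :: "'v set \<Rightarrow> ('v \<Rightarrow> 'a::complex_inner set) \<Rightarrow> ('v \<Rightarrow> 'a) set"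
  where "dsum V H =
    {f. (\<forall>v\<in>V. f v \<in> H v) \<and> (\<forall>v. v \<notin> V \<longrightarrow> f v = 0) \<and> (\<lambda>v. (norm (f v))\<^sup>2) summable_on V}"

definition dsum_inner :: "'v set \<Rightarrow> ('v \<Rightarrow> 'a::complex_inner) \<Rightarrow> ('v \<Rightarrow> 'a) \<Rightarrow> complex"
  where "dsum_inner V f g = (\<Sum>\<^sub>\<infinity>v\<in>V. cinner (f v) (g v))"

definition single :: "'v \<Rightarrow> 'a \<Rightarrow> 'v \<Rightarrow> 'a::complex_inner"
  where "single v x = (\<lambda>u. if u = v then x else 0)"

text \<open>
  Operators between direct sums are total functions; only their values on the direct sum matter.
\<close>

definition dsum_unitary ::
  "'v set \<Rightarrow> ('v \<Rightarrow> 'a::complex_inner set) \<Rightarrow> 'w set \<Rightarrow> ('w \<Rightarrow> 'b::complex_inner set) \<Rightarrow>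
    (('v \<Rightarrow> 'a) \<Rightarrow> ('w \<Rightarrow> 'b)) \<Rightarrow> bool"
  where "dsum_unitary V H V' H' W \<longleftrightarrow>
    bij_betw W (dsum V H) (dsum V' H') \<and>
    (\<forall>f\<in>dsum V H. \<forall>g\<in>dsum V H. W (\<lambda>v. f v + g v) = (\<lambda>w. W f w + W g w)) \<and>
    (\<forall>c. \<forall>f\<in>dsum V H. W (\<lambda>v. c *\<^sub>C f v) = (\<lambda>w. c *\<^sub>C W f w)) \<and>
    (\<forall>f\<in>dsum V H. \<forall>g\<in>dsum V H. dsum_inner V' (W f) (W g) = dsum_inner V f g)"

definition dsum_adjoint ::
  "'v set \<Rightarrow> ('v \<Rightarrow> 'a::complex_inner set) \<Rightarrow> 'w set \<Rightarrow>
    (('v \<Rightarrow> 'a) \<Rightarrow> ('w \<Rightarrow> 'b::complex_inner)) \<Rightarrow> ('w \<Rightarrow> 'b) \<Rightarrow> ('v \<Rightarrow> 'a)"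
  where "dsum_adjoint V H V' W g =
    (THE f. f \<in> dsum V H \<and> (\<forall>h\<in>dsum V H. dsum_inner V h f = dsum_inner V' (W h) g))"


section \<open>Quantum walks\<close>

definition quantum_walk ::
  "'v set \<Rightarrow> ('v \<Rightarrow> 'a::complex_inner set) \<Rightarrow> (('v \<Rightarrow> 'a) \<Rightarrow> ('v \<Rightarrow> 'a)) \<Rightarrow> bool"
  where "quantum_walk V H U \<longleftrightarrow>
    countable V \<and>
    (\<forall>v\<in>V. hilbert_subspace (H v) \<and> separable_space (top_of_set (H v))) \<and>
    dsum_unitary V H V H U"

definition vproj :: "'v \<Rightarrow> ('v \<Rightarrow> 'a::complex_inner) \<Rightarrow> 'v \<Rightarrow> 'a"
  where "vproj v f = single v (f v)"

definition component ::
  "(('v \<Rightarrow> 'a::complex_inner) \<Rightarrow> ('v \<Rightarrow> 'a)) \<Rightarrow> 'v \<Rightarrow> 'v \<Rightarrow> ('v \<Rightarrow> 'a) \<Rightarrow> ('v \<Rightarrow> 'a)"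
  where "component U u v = vproj u \<circ> U \<circ> vproj v"

text \<open>The component \<open>P\<^sub>u U P\<^sub>v\<close>, regarded as an operator from \<open>H v\<close> to \<open>H u\<close>.\<close>

definition block ::
  "(('v \<Rightarrow> 'a::complex_inner) \<Rightarrow> ('v \<Rightarrow> 'a)) \<Rightarrow> 'v \<Rightarrow> 'v \<Rightarrow> 'a \<Rightarrow> 'a"
  where "block U u v x = component U u v (single v x) u"

text \<open>
  \<open>complex_vector.dim\<close> is \<open>0\<close> on infinite-dimensional spaces, hence the case distinction.
\<close>

definition rank_on :: "'a::complex_inner set \<Rightarrow> ('a \<Rightarrow> 'b::complex_inner) \<Rightarrow> enat"
  where "rank_on S T =
    (if \<exists>B. finite B \<and> T ` S \<subseteq> complex_vector.span B then enat (complex_vector.dim (T ` S)) else \<infinity>)"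

text \<open>The number of directed edges from \<open>v\<close> to \<open>u\<close> in the graph of the walk.\<close>

definition edge_count ::
  "('v \<Rightarrow> 'a::complex_inner set) \<Rightarrow> (('v \<Rightarrow> 'a) \<Rightarrow> ('v \<Rightarrow> 'a)) \<Rightarrow> 'v \<Rightarrow> 'v \<Rightarrow> enat"
  where "edge_count H U u v = rank_on (H v) (block U u v)"

definition one_dimensional_qw ::
  "(int \<Rightarrow> 'a::complex_inner set) \<Rightarrow> ((int \<Rightarrow> 'a) \<Rightarrow> (int \<Rightarrow> 'a)) \<Rightarrow> bool"
  where "one_dimensional_qw H U \<longleftrightarrow>
    quantum_walk UNIV H U \<and>
    (\<forall>n. complex_vector.dim (H n) = 2) \<and>
    (\<forall>m n. edge_count H U m n = (if \<bar>m - n\<bar> = 1 then 1 else 0))"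

definition translation_invariant ::
  "(int \<Rightarrow> 'a::complex_inner set) \<Rightarrow> ((int \<Rightarrow> 'a) \<Rightarrow> (int \<Rightarrow> 'a)) \<Rightarrow> bool"
  where "translation_invariant H U \<longleftrightarrow>
    (\<forall>n. H n = H (n + 1)) \<and>
    (\<forall>m n. \<forall>x\<in>H n. block U m n x = block U (m + 1) (n + 1) x)"

definition unitary_equivalent ::
  "'v set \<Rightarrow> ('v \<Rightarrow> 'a::complex_inner set) \<Rightarrow> (('v \<Rightarrow> 'a) \<Rightarrow> ('v \<Rightarrow> 'a)) \<Rightarrow>
    'w set \<Rightarrow> ('w \<Rightarrow> 'b::complex_inner set) \<Rightarrow> (('w \<Rightarrow> 'b) \<Rightarrow> ('w \<Rightarrow> 'b)) \<Rightarrow> bool"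
  where "unitary_equivalent V\<^sub>1 H\<^sub>1 U\<^sub>1 V\<^sub>2 H\<^sub>2 U\<^sub>2 \<longleftrightarrow>
    (\<exists>W \<phi>. dsum_unitary V\<^sub>1 H\<^sub>1 V\<^sub>2 H\<^sub>2 W \<and> bij_betw \<phi> V\<^sub>1 V\<^sub>2 \<and>
      (\<forall>v\<in>V\<^sub>1. W ` (single v ` H\<^sub>1 v) = single (\<phi> v) ` H\<^sub>2 (\<phi> v)) \<and>
      (\<forall>g\<in>dsum V\<^sub>2 H\<^sub>2. W (U\<^sub>1 (dsum_adjoint V\<^sub>1 H\<^sub>1 V\<^sub>2 W g)) = U\<^sub>2 g))"


section \<open>The four classes of one-dimensional walks\<close>

abbreviation coin_space :: "int \<Rightarrow> (complex^2) set"
  where "coin_space \<equiv> (\<lambda>n. UNIV)"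

definition mat2 :: "complex \<Rightarrow> complex \<Rightarrow> complex \<Rightarrow> complex \<Rightarrow> complex^2^2"
  where "mat2 a b c d = vector [vector [a, b], vector [c, d]]"

text \<open>The operator \<open>|m\<rangle>\<langle>n| \<otimes> A\<close>.\<close>

definition ketbra :: "int \<Rightarrow> int \<Rightarrow> complex^2^2 \<Rightarrow> (int \<Rightarrow> complex^2) \<Rightarrow> (int \<Rightarrow> complex^2)"
  where "ketbra m n A f = single m (A *v f n)"

text \<open>
  \<open>L\<close> and \<open>R\<close> give the shapes of the components \<open>U\<^sub>n\<^sub>-\<^sub>1\<^sub>,\<^sub>n\<close> and \<open>U\<^sub>n\<^sub>+\<^sub>1\<^sub>,\<^sub>n\<close> as functions of the entries
  \<open>a\<^sub>n\<close>, \<open>b\<^sub>n\<close>, \<open>c\<^sub>n\<close>, \<open>d\<^sub>n\<close>.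
\<close>

definition walk_class ::
  "(complex \<Rightarrow> complex \<Rightarrow> complex \<Rightarrow> complex \<Rightarrow> complex^2^2) \<Rightarrow>
   (complex \<Rightarrow> complex \<Rightarrow> complex \<Rightarrow> complex \<Rightarrow> complex^2^2) \<Rightarrow>
   ((int \<Rightarrow> complex^2) \<Rightarrow> (int \<Rightarrow> complex^2)) set"
  where "walk_class L R =
    {U. one_dimensional_qw coin_space U \<and>
      (\<exists>a b c d :: int \<Rightarrow> complex. \<forall>n. \<forall>f\<in>dsum UNIV coin_space.
        component U (n - 1) n f = ketbra (n - 1) n (L (a n) (b n) (c n) (d n)) f \<and>
        component U (n + 1) n f = ketbra (n + 1) n (R (a n) (b n) (c n) (d n)) f)}"

definition class1 :: "((int \<Rightarrow> complex^2) \<Rightarrow> (int \<Rightarrow> complex^2)) set"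
  where "class1 = walk_class (\<lambda>a b c d. mat2 a b 0 0) (\<lambda>a b c d. mat2 0 0 c d)"

definition class2 :: "((int \<Rightarrow> complex^2) \<Rightarrow> (int \<Rightarrow> complex^2)) set"
  where "class2 = walk_class (\<lambda>a b c d. mat2 a 0 c 0) (\<lambda>a b c d. mat2 0 b 0 d)"

definition class3 :: "((int \<Rightarrow> complex^2) \<Rightarrow> (int \<Rightarrow> complex^2)) set"
  where "class3 = walk_class (\<lambda>a b c d. mat2 0 0 c d) (\<lambda>a b c d. mat2 a b 0 0)"

definition class4 :: "((int \<Rightarrow> complex^2) \<Rightarrow> (int \<Rightarrow> complex^2)) set"
  where "class4 = walk_class (\<lambda>a b c d. mat2 0 b 0 d) (\<lambda>a b c d. mat2 a 0 c 0)"

end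

theory Submission
  imports Defs
begin

text \<open>
  A translation-invariant walk on a two-dimensional space \<open>K\<close> is \<open>(U f)\<^sub>n = A f\<^sub>n\<^sub>+\<^sub>1 + B f\<^sub>n\<^sub>-\<^sub>1\<close> with
  \<open>A\<close> and \<open>B\<close> of rank one, and unitarity of \<open>U\<close> gives \<open>A\<^sup>*A + B\<^sup>*B = 1\<close> and \<open>B\<^sup>*A = 0\<close>. By the
  second identity the ranges of \<open>A\<close> and \<open>B\<close> are orthogonal lines; by the first one so are their
  kernels. Writing \<open>U\<close> in an orthonormal basis of \<open>K\<close> adapted to the ranges gives a walk in
  \<open>C\<^sub>1\<close> or \<open>C\<^sub>3\<close>, depending on the order of the two vectors, and a basis adapted to the kernels
  gives one in \<open>C\<^sub>2\<close> or \<open>C\<^sub>4\<close>.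
\<close>

section \<open>Sesquilinearity of the inner product\<close>

lemma cinner_scaleC_left: "cinner (a *\<^sub>C x) y = cnj a * cinner x (y::'a::complex_inner)"
  by (subst cinner_commute, subst cinner_scaleC_right, subst (2) cinner_commute) simp

lemma cinner_add_left: "cinner (x + y) z = cinner x z + cinner y (z::'a::complex_inner)"
  by (subst cinner_commute, subst cinner_add_right) (simp flip: cinner_commute)

lemma cinner_zero_right [simp]: "cinner x (0::'a::complex_inner) = 0"
  using cinner_scaleC_right[of x 0 0] by simp

lemma cinner_zero_left [simp]: "cinner (0::'a::complex_inner) x = 0"
  by (subst cinner_commute) simp

lemma cinner_diff_right: "cinner x (y - z) = cinner x y - cinner x (z::'a::complex_inner)"
  using cinner_add_right[of x "y - z" z] by simp

lemma cinner_self_eq_0_iff [simp]: "cinner x x = 0 \<longleftrightarrow> x = (0::'a::complex_inner)"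
  by (simp add: cinner_self)

lemmas cinner_linear_simps =
  cinner_scaleC_left cinner_scaleC_right cinner_add_left cinner_add_right

section \<open>Orthonormal bases of two-dimensional spaces\<close>

text \<open>Spanning is left out of the definition: orthonormal vectors are independent, so in
  dimension two they span, as \<open>orthonormal_basis2_span\<close> derives.\<close>

definition orthonormal_basis2 :: "'a::complex_inner set \<Rightarrow> 'a \<Rightarrow> 'a \<Rightarrow> bool"
  where "orthonormal_basis2 K v w \<longleftrightarrow>
    complex_vector.subspace K \<and> complex_vector.dim K = 2 \<and> v \<in> K \<and> w \<in> K \<and>
    cinner v v = 1 \<and> cinner w w = 1 \<and> cinner v w = 0"

lemma orthonormal_basis2_commute: "orthonormal_basis2 K v w \<Longrightarrow> orthonormal_basis2 K w v"
  using cinner_commute[of w v] by (simp add: orthonormal_basis2_def)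

lemma orthonormal_independent:
  fixes v w :: "'a::complex_inner"
  assumes "cinner v v = 1" "cinner w w = 1" "cinner v w = 0"
  shows "v \<noteq> w" "complex_vector.independent {v, w}"
proof -
  show "v \<noteq> w"
    using assms by auto
  have "w \<noteq> 0"
    using assms by auto
  have "v \<notin> complex_vector.span {w}"
  proof
    assume "v \<in> complex_vector.span {w}"
    then obtain k where k: "v = k *\<^sub>C w"
      by (auto simp: complex_vector.span_singleton)
    have "cinner v w = cnj k"
      using assms by (simp add: k cinner_scaleC_left)
    then show False
      using assms k by simp
  qed
  then show "complex_vector.independent {v, w}"
    using \<open>w \<noteq> 0\<close> by (simp add: complex_vector.independent_insertI)
qed

text \<open>A vector of \<open>K\<close> outside the span would give three independent vectors in
  the span of a two-element basis of \<open>K\<close>.\<close>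

lemma orthonormal_basis2_span:
  assumes "orthonormal_basis2 K v w"
  shows "K = complex_vector.span {v, w}"
proof
  note K = assms[unfolded orthonormal_basis2_def]
  show "complex_vector.span {v, w} \<subseteq> K"
    using K by (intro complex_vector.span_minimal) auto
  have ind: "v \<noteq> w" "complex_vector.independent {v, w}"
    using orthonormal_independent[of v w] K by auto
  show "K \<subseteq> complex_vector.span {v, w}"
  proof (rule ccontr)
    assume "\<not> K \<subseteq> complex_vector.span {v, w}"
    then obtain y where y: "y \<in> K" "y \<notin> complex_vector.span {v, w}"
      by auto
    then have y': "y \<notin> {v, w}"
      by (metis complex_vector.span_base)
    obtain B where B: "B \<subseteq> K" "K \<subseteq> complex_vector.span B" "card B = 2"
      by (rule complex_vector.basis_exists[of K]) (use K in auto)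
    have "finite B"
      using B(3) by (metis card.infinite zero_neq_numeral)
    moreover have "complex_vector.independent {y, v, w}"
      using y ind by (simp add: complex_vector.independent_insertI)
    moreover have "{y, v, w} \<subseteq> complex_vector.span B"
      using y K B by auto
    ultimately have "card {y, v, w} \<le> 2"
      using complex_vector.independent_span_bound B(3) by metis
    then show False
      using ind y' by simp
  qed
qed

lemma orthonormal_basis2_expand:
  assumes "orthonormal_basis2 K v w" "y \<in> K"
  shows "y = cinner v y *\<^sub>C v + cinner w y *\<^sub>C w"
proof -
  note K = assms(1)[unfolded orthonormal_basis2_def]
  have "cinner w v = 0"
    using K cinner_commute[of w v] by simp
  moreover obtain a b where "y = a *\<^sub>C v + b *\<^sub>C w"
    using assms orthonormal_basis2_span[OF assms(1)]
    by (auto simp: complex_vector.span_insert complex_vector.span_singleton algebra_simps)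
  ultimately show ?thesis
    using K by (simp add: cinner_linear_simps)
qed

text \<open>Normalisation suffices. Keeping the new vectors as multiples of \<open>v\<close> and
  \<open>w\<close> lets them inherit orthogonality and kernel relations by linearity.\<close>

lemma orthonormal_basis2_exists:
  fixes K :: "'a::complex_inner set"
  assumes "complex_vector.subspace K" "complex_vector.dim K = 2"
    and "v \<in> K" "w \<in> K" "v \<noteq> 0" "w \<noteq> 0" "cinner v w = 0"
  shows "\<exists>a b. orthonormal_basis2 K (a *\<^sub>C v) (b *\<^sub>C w)"
proof -
  have unit: "cinner (of_real (1 / norm x) *\<^sub>C x) (of_real (1 / norm x) *\<^sub>C x) = 1"
    if "x \<noteq> 0" for x :: 'a
    using that cinner_self[of x] by (simp add: cinner_linear_simps power2_eq_square)
  show ?thesis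
    unfolding orthonormal_basis2_def
    using assms unit[of v] unit[of w]
    by (intro exI[of _ "of_real (1 / norm v)"] exI[of _ "of_real (1 / norm w)"])
      (simp add: cinner_scaleC_left cinner_scaleC_right complex_vector.subspace_scale)
qed

text \<open>Rank-nullity in dimension two: for a basis \<open>v\<close>, \<open>w\<close> with
  \<open>T v = a u\<close> and \<open>T w = b u\<close>, the vector \<open>b v - a w\<close> is
  killed, and it is nonzero by independence if \<open>a\<close> is nonzero; otherwise
  \<open>v\<close> itself is killed.\<close>

lemma exists_kernel_vector:
  fixes K :: "'a::complex_inner set"
  assumes K: "complex_vector.subspace K" "complex_vector.dim K = 2"
    and lin: "\<And>a b x y. x \<in> K \<Longrightarrow> y \<in> K \<Longrightarrow> T (a *\<^sub>C x + b *\<^sub>C y) = a *\<^sub>C T x + b *\<^sub>C T y"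
    and range: "T ` K \<subseteq> complex_vector.span {u}"
  shows "\<exists>x\<in>K. x \<noteq> 0 \<and> T x = 0"
proof -
  obtain B where B: "B \<subseteq> K" "complex_vector.independent B" "card B = 2"
    using complex_vector.basis_exists[of K] K by metis
  then obtain v w where vw: "B = {v, w}" "v \<noteq> w"
    by (auto simp: card_2_iff)
  have "T v \<in> complex_vector.span {u}" "T w \<in> complex_vector.span {u}"
    using range B vw by auto
  then obtain a b where ab: "T v = a *\<^sub>C u" "T w = b *\<^sub>C u"
    by (auto simp: complex_vector.span_singleton)
  show ?thesis
  proof (cases "a = 0")
    case True
    then show ?thesis
      using B vw ab by (auto simp: complex_vector.dependent_zero intro!: bexI[of _ v])
  next
    case False
    have "T (b *\<^sub>C v + (- a) *\<^sub>C w) = 0"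
      using B vw ab by (subst lin) (auto simp: mult.commute)
    moreover have "b *\<^sub>C v + (- a) *\<^sub>C w \<noteq> 0"
    proof
      assume "b *\<^sub>C v + (- a) *\<^sub>C w = 0"
      then have "a *\<^sub>C w = b *\<^sub>C v"
        by simp
      then have "w = (b / a) *\<^sub>C v"
        using False by (metis complex_vector.scale_scale complex_vector.scale_one
            divide_inverse left_inverse mult.commute)
      then have "w \<in> complex_vector.span {v}"
        by (auto simp: complex_vector.span_singleton)
      moreover have "complex_vector.independent {w, v}"
        using B(2) vw by (simp add: insert_commute)
      ultimately show False
        using vw by (simp add: complex_vector.independent_insert)
    qed
    moreover have "b *\<^sub>C v + (- a) *\<^sub>C w \<in> K"
      using B vw K
      by (intro complex_vector.subspace_add complex_vector.subspace_scale) auto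
    ultimately show ?thesis
      by blast
  qed
qed

section \<open>Unitaries between direct sums\<close>

lemma single_in_dsum:
  assumes "\<And>u. complex_vector.subspace (H u)" "x \<in> H v"
  shows "single v x \<in> dsum UNIV H"
proof -
  have "(\<lambda>u. (norm (single v x u))\<^sup>2) summable_on UNIV
      \<longleftrightarrow> (\<lambda>u. (norm (single v x u))\<^sup>2) summable_on {v}"
    by (rule summable_on_cong_neutral) (auto simp: single_def)
  then show ?thesis
    using assms by (auto simp: dsum_def single_def complex_vector.subspace_0)
qed

lemma dsum_inner_single_left: "dsum_inner UNIV (single v x) f = cinner x (f v)"
proof -
  have "dsum_inner UNIV (single v x) f = (\<Sum>\<^sub>\<infinity>u\<in>{v}. cinner (single v x u) (f u))"
    unfolding dsum_inner_def by (rule infsum_cong_neutral) (auto simp: single_def)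
  then show ?thesis
    by (simp add: single_def)
qed

text \<open>The adjoint of a unitary is its inverse. As \<open>W\<close> is isometric,
  \<open>f\<close> is one solution of the defining equation; any other solution \<open>g\<close> has
  the same inner products, and testing with \<open>g v - f v\<close> placed at \<open>v\<close>
  forces \<open>g v = f v\<close>.\<close>

lemma dsum_adjoint_unitary:
  assumes H: "\<And>v. complex_vector.subspace (H v)"
    and W: "dsum_unitary UNIV H V' H' W"
    and f: "f \<in> dsum UNIV H"
  shows "dsum_adjoint UNIV H V' W (W f) = f"
  unfolding dsum_adjoint_def
proof (rule the_equality)
  have iso: "dsum_inner V' (W h) (W f) = dsum_inner UNIV h f" if "h \<in> dsum UNIV H" for h
    using W f that by (simp add: dsum_unitary_def)
  then show "f \<in> dsum UNIV H \<and>
      (\<forall>h\<in>dsum UNIV H. dsum_inner UNIV h f = dsum_inner V' (W h) (W f))"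
    using f by simp
  fix g
  assume g: "g \<in> dsum UNIV H \<and>
      (\<forall>h\<in>dsum UNIV H. dsum_inner UNIV h g = dsum_inner V' (W h) (W f))"
  show "g = f"
  proof
    fix v
    let ?x = "g v - f v"
    have x: "?x \<in> H v"
      using f g H by (intro complex_vector.subspace_diff) (auto simp: dsum_def)
    then have s: "single v ?x \<in> dsum UNIV H"
      using H by (intro single_in_dsum)
    have "dsum_inner UNIV (single v ?x) g = dsum_inner UNIV (single v ?x) f"
      using g s iso by simp
    then have "cinner ?x ?x = 0"
      by (simp add: dsum_inner_single_left cinner_diff_right)
    then show "g v = f v"
      by simp
  qed
qed

lemma dsum_unitary_compose:
  assumes "dsum_unitary V H V' H' W" "dsum_unitary V' H' V'' H'' W'"
  shows "dsum_unitary V H V'' H'' (\<lambda>f. W' (W f))"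
proof -
  have "W f \<in> dsum V' H'" if "f \<in> dsum V H" for f
    using assms that by (auto simp: dsum_unitary_def bij_betw_def)
  then show ?thesis
    using assms bij_betw_trans[of W "dsum V H" "dsum V' H'" W' "dsum V'' H''"]
    by (simp add: dsum_unitary_def comp_def)
qed

text \<open>\<open>R\<close> applied at every vertex is the inverse. Both maps preserve norms, hence
  also square summability.\<close>

lemma dsum_unitary_pointwise:
  fixes T :: "'a::complex_inner \<Rightarrow> 'b::complex_inner"
  assumes T: "\<And>x. x \<in> S \<Longrightarrow> T x \<in> S'" and R: "\<And>y. y \<in> S' \<Longrightarrow> R y \<in> S"
    and RT: "\<And>x. x \<in> S \<Longrightarrow> R (T x) = x" and TR: "\<And>y. y \<in> S' \<Longrightarrow> T (R y) = y"
    and add: "\<And>x y. T (x + y) = T x + T y" and scale: "\<And>c x. T (c *\<^sub>C x) = c *\<^sub>C T x"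
    and inner: "\<And>x y. x \<in> S \<Longrightarrow> y \<in> S \<Longrightarrow> cinner (T x) (T y) = cinner x y"
  shows "dsum_unitary UNIV (\<lambda>_. S) UNIV (\<lambda>_. S') (\<lambda>f (v::'v). T (f v))"
proof -
  have norm: "norm (T x) = norm x" if "x \<in> S" for x
  proof -
    have "complex_of_real ((norm (T x))\<^sup>2) = of_real ((norm x)\<^sup>2)"
      using inner[of x x] that by (simp only: cinner_self)
    then have "(norm (T x))\<^sup>2 = (norm x)\<^sup>2"
      by (simp only: of_real_eq_iff)
    then show ?thesis
      by simp
  qed
  have normR: "norm (R y) = norm y" if "y \<in> S'" for y
    using norm[of "R y"] TR[of y] R[of y] that by simp
  have "bij_betw (\<lambda>f (v::'v). T (f v)) (dsum UNIV (\<lambda>_. S)) (dsum UNIV (\<lambda>_. S'))"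
    by (rule bij_betw_byWitness[where f' = "\<lambda>g v. R (g v)"])
      (auto simp: dsum_def RT TR T R norm normR)
  moreover have "dsum_inner UNIV (\<lambda>v. T (f v)) (\<lambda>v. T (g v)) = dsum_inner UNIV f g"
    if "f \<in> dsum UNIV (\<lambda>_. S)" "g \<in> dsum UNIV (\<lambda>_. S)" for f g :: "'v \<Rightarrow> 'a"
    using that by (simp add: dsum_inner_def dsum_def inner)
  ultimately show ?thesis
    by (simp add: dsum_unitary_def add scale)
qed

section \<open>Blocks of a walk\<close>

lemma block_eq: "block U m n x = U (single n x) m"
  by (simp add: block_def component_def vproj_def single_def)

lemma component_eq: "component U m n f = single m (block U m n (f n))"
  by (simp add: block_eq component_def vproj_def)

lemma block_in:
  assumes "dsum_unitary UNIV H UNIV H U" "\<And>v. complex_vector.subspace (H v)" "x \<in> H n"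
  shows "block U m n x \<in> H m"
proof -
  have "U (single n x) \<in> dsum UNIV H"
    using assms single_in_dsum[of H x n] by (auto simp: dsum_unitary_def bij_betw_def)
  then show ?thesis
    by (simp add: block_eq dsum_def)
qed

lemma block_linear:
  assumes U: "dsum_unitary UNIV H UNIV H U" and H: "\<And>v. complex_vector.subspace (H v)"
    and x: "x \<in> H n" and y: "y \<in> H n"
  shows "block U m n (a *\<^sub>C x + b *\<^sub>C y) = a *\<^sub>C block U m n x + b *\<^sub>C block U m n y"
proof -
  have split: "single n (a *\<^sub>C x + b *\<^sub>C y) = (\<lambda>v. single n (a *\<^sub>C x) v + single n (b *\<^sub>C y) v)"
    and scale: "single n (c *\<^sub>C z) = (\<lambda>v. c *\<^sub>C single n z v)" for c z
    by (auto simp: single_def)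
  have in_dsum: "single n z \<in> dsum UNIV H" if "z \<in> H n" for z
    using single_in_dsum[of H z n] H that by simp
  have "U (single n (a *\<^sub>C x + b *\<^sub>C y)) =
      (\<lambda>v. U (single n (a *\<^sub>C x)) v + U (single n (b *\<^sub>C y)) v)"
    unfolding split
    using U in_dsum x y H by (simp add: dsum_unitary_def complex_vector.subspace_scale)
  moreover have "U (single n (c *\<^sub>C z)) = (\<lambda>v. c *\<^sub>C U (single n z) v)" if "z \<in> H n" for c z
    unfolding scale using U in_dsum that by (simp add: dsum_unitary_def)
  ultimately show ?thesis
    using x y by (simp add: block_eq)
qed

lemma edge_count_0_block:
  assumes "edge_count H U m n = 0" "x \<in> H n"
  shows "block U m n x = 0"
proof -
  let ?X = "block U m n ` H n"
  obtain B where B: "finite B" "?X \<subseteq> complex_vector.span B" and "complex_vector.dim ?X = 0"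
    using assms(1) by (auto simp: edge_count_def rank_on_def zero_enat_def split: if_splits)
  then obtain C where C: "C \<subseteq> ?X" "complex_vector.independent C"
      "?X \<subseteq> complex_vector.span C" "card C = 0"
    using complex_vector.basis_exists[of ?X] by metis
  \<comment> \<open>\<open>card C = 0\<close> alone would allow an infinite \<open>C\<close>; the
    finite \<open>B\<close> bounds the independent set \<open>C\<close>, which is therefore
    empty.\<close>
  then have "finite C"
    using complex_vector.independent_span_bound[of B C] B by auto
  then have "?X \<subseteq> {0}"
    using C by simp
  then show ?thesis
    using assms(2) by auto
qed

text \<open>A basis of the image, chosen inside the image, is a single vector: it spans the image
  and is nonzero by independence.\<close>

lemma edge_count_1_block:
  assumes "edge_count H U m n = 1"
  shows "\<exists>u. block U m n ` H n \<subseteq> complex_vector.span {u}"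
    and "\<exists>x\<in>H n. block U m n x \<noteq> 0"
proof -
  let ?X = "block U m n ` H n"
  have dim: "complex_vector.dim ?X = 1"
    using assms by (auto simp: edge_count_def rank_on_def one_enat_def split: if_splits)
  obtain C where C: "C \<subseteq> ?X" "complex_vector.independent C"
      "?X \<subseteq> complex_vector.span C" "card C = 1"
    using complex_vector.basis_exists[of ?X] dim by metis
  then obtain u where u: "C = {u}"
    by (auto simp: card_1_singleton_iff)
  then show "\<exists>u. ?X \<subseteq> complex_vector.span {u}"
    using C by auto
  have "u \<noteq> 0" "u \<in> ?X"
    using C u by auto
  then show "\<exists>x\<in>H n. block U m n x \<noteq> 0"
    by auto
qed

lemma translation_invariant_block:
  fixes k :: int
  assumes "translation_invariant H U"
  shows "H k = H 0" "x \<in> H 0 \<Longrightarrow> block U (m + k) k x = block U m 0 x"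
proof -
  have step: "H n = H (n + 1)" "x \<in> H n \<Longrightarrow> block U m n x = block U (m + 1) (n + 1) x" for m n x
    using assms by (auto simp: translation_invariant_def)
  \<comment> \<open>Both claims go through one induction, because the block equation at
    \<open>i\<close> holds only on \<open>H i\<close>, which has to be identified with
    \<open>H 0\<close>.\<close>
  have "H k = H 0 \<and> (\<forall>x\<in>H 0. block U (m + k) k x = block U m 0 x)"
  proof (induction k rule: int_induct[where k = 0])
    case base
    show ?case by simp
  next
    case (step1 i)
    then show ?case
      using step(1)[of i] step(2)[of _ i "m + i"] by (simp add: add.assoc)
  next
    case (step2 i)
    then show ?case
      using step(1)[of "i - 1"] step(2)[of _ "i - 1" "m + (i - 1)"] by (simp add: algebra_simps)
  qed
  then show "H k = H 0" "x \<in> H 0 \<Longrightarrow> block U (m + k) k x = block U m 0 x"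
    by auto
qed

section \<open>Change of basis\<close>

lemma cinner_vec2:
  fixes x y :: "complex^2"
  shows "cinner x y = cnj (x $ 1) * y $ 1 + cnj (x $ 2) * y $ 2"
  by (simp add: cinner_vec_def sum_2 cinner_complex_def)

text \<open>This makes dimension theory available: the dimension of the coin space, and invariance
  of dimension under injective linear maps out of it.\<close>

lemma coin_space_finite_dimensional:
  "finite_dimensional_vector_space (scaleC :: complex \<Rightarrow> complex^2 \<Rightarrow> complex^2)
    {axis 1 1, axis 2 1}"
proof
  show "complex_vector.independent {axis 1 1, axis 2 1 :: complex^2}"
    by (rule orthonormal_independent) (simp_all add: cinner_vec2 axis_def)
  have "x \<in> complex_vector.span {axis 1 1, axis 2 1}" for x :: "complex^2"
  proof -
    have "x = (x $ 1) *\<^sub>C axis 1 1 + (x $ 2) *\<^sub>C axis 2 1"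
      by (simp add: vec_eq_iff forall_2 scaleC_vec_def scaleC_complex_def axis_def)
    also have "\<dots> \<in> complex_vector.span {axis 1 1, axis 2 1}"
      by (intro complex_vector.span_add complex_vector.span_scale complex_vector.span_base) auto
    finally show ?thesis .
  qed
  then show "complex_vector.span {axis 1 1, axis 2 1 :: complex^2} = UNIV"
    by auto
qed simp

lemma vec2_eq_iff: "x = y \<longleftrightarrow> x $ 1 = y $ 1 \<and> x $ 2 = (y::'a^2) $ 2"
  by (simp add: vec_eq_iff forall_2)

lemma mat2_mult_vector:
  "mat2 a b c d *v x = vector [a * x $ 1 + b * x $ 2, c * x $ 1 + d * x $ 2]"
  by (simp add: vec2_eq_iff mat2_def matrix_vector_mult_def sum_2)

text \<open>The walk is conjugated, at every vertex alike, by the isometry from coordinates to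
  \<open>H 0\<close> given by the basis. The numbers \<open>e m\<close> are the entries of the block
  from \<open>0\<close> to \<open>m\<close> in that basis.\<close>

lemma change_of_basis:
  fixes H :: "int \<Rightarrow> 'a::complex_inner set"
  assumes walk: "one_dimensional_qw H U" and trans: "translation_invariant H U"
    and onb: "orthonormal_basis2 (H 0) v w"
  defines "e \<equiv> \<lambda>m x y. cinner x (block U m 0 y)"
  shows "\<exists>U'. one_dimensional_qw coin_space U' \<and> translation_invariant coin_space U' \<and>
    unitary_equivalent UNIV coin_space U' UNIV H U \<and>
    (\<forall>m n x. block U' (n + m) n x = mat2 (e m v v) (e m v w) (e m w v) (e m w w) *v x)"
proof -
  define K where "K = H 0"
  have HK: "H = (\<lambda>_. K)"
    using translation_invariant_block(1)[OF trans] by (auto simp: K_def)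
  note onb = onb[folded K_def]
  note K = onb[unfolded orthonormal_basis2_def]
  have sub: "complex_vector.subspace (H n)" for n
    using K HK by simp
  have U: "dsum_unitary UNIV H UNIV H U"
    and edges: "edge_count H U m n = (if \<bar>m - n\<bar> = 1 then 1 else 0)" for m n
    using walk by (auto simp: one_dimensional_qw_def quantum_walk_def)
  have wv: "cinner w v = 0"
    using K cinner_commute[of w v] by simp
  \<comment> \<open>\<open>T\<close> turns coordinates into vectors and \<open>R\<close> takes
    coordinates. They are mutually inverse between the coin space and \<open>K\<close>; outside
    \<open>K\<close>, \<open>R\<close> sees only the orthogonal projection to
    \<open>K\<close>.\<close>
  define T where "T x = (x $ 1) *\<^sub>C v + (x $ 2) *\<^sub>C w" for x :: "complex^2"
  define R where "R y = (vector [cinner v y, cinner w y] :: complex^2)" for y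
  have T_in: "T x \<in> K" for x
    unfolding T_def using K
    by (intro complex_vector.subspace_add complex_vector.subspace_scale) auto
  have RT: "R (T x) = x" for x
    using K wv by (simp add: R_def T_def vec2_eq_iff cinner_linear_simps)
  have TR: "T (R y) = y" if "y \<in> K" for y
    using orthonormal_basis2_expand[OF onb that] by (simp add: R_def T_def)
  have T_range: "range T = K"
    using T_in TR by (metis (no_types, lifting) image_subset_iff rangeI subsetI subset_antisym)
  have T_lin: "T (x + y) = T x + T y" "T (c *\<^sub>C x) = c *\<^sub>C T x" for c x y
    by (simp_all add: T_def scaleC_vec_def scaleC_complex_def scaleC_add_left scaleC_add_right
        scaleC_scaleC)
  have R_lin: "R (x + y) = R x + R y" "R (c *\<^sub>C x) = c *\<^sub>C R x" for c x y
    by (simp_all add: R_def vec2_eq_iff scaleC_vec_def scaleC_complex_def cinner_linear_simps)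
  have T_inner: "cinner (T x) (T y) = cinner x y" for x y
    using K wv by (simp add: T_def cinner_linear_simps cinner_vec2 algebra_simps)
  have T0: "T 0 = 0"
    by (simp add: T_def)
  define W where "W f = (\<lambda>n::int. T (f n))" for f
  \<comment> \<open>This is the inverse of \<open>W\<close> after \<open>U\<close> after
    \<open>W\<close>, the inverse being \<open>R\<close> at every vertex.\<close>
  define U' where "U' f = (\<lambda>n. R (U (W f) n))" for f
  have W: "dsum_unitary UNIV coin_space UNIV H W"
    unfolding HK W_def
    by (rule dsum_unitary_pointwise[where R = R]) (simp_all add: T_in RT TR T_lin T_inner)
  have W_inv: "dsum_unitary UNIV H UNIV coin_space (\<lambda>f n. R (f n))"
    unfolding HK
  proof (rule dsum_unitary_pointwise[where R = T])
    show "cinner (R x) (R y) = cinner x y" if "x \<in> K" "y \<in> K" for x y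
      using T_inner[of "R x" "R y"] that by (simp add: TR)
  qed (simp_all add: T_in RT TR R_lin)
  have U': "dsum_unitary UNIV coin_space UNIV coin_space U'"
    unfolding U'_def
    by (rule dsum_unitary_compose[OF dsum_unitary_compose[OF W U] W_inv])
  have W_single: "W (single n x) = single n (T x)" for n x
    by (auto simp: W_def single_def T0)
  have block': "block U' m n x = R (block U m n (T x))" for m n x
    by (simp add: block_eq U'_def W_single)

  interpret coin: finite_dimensional_vector_space "scaleC :: complex \<Rightarrow> complex^2 \<Rightarrow> complex^2"
    "{axis 1 1, axis 2 1}"
    by (rule coin_space_finite_dimensional)
  interpret pair: finite_dimensional_vector_space_pair_1
    "scaleC :: complex \<Rightarrow> complex^2 \<Rightarrow> complex^2" "{axis 1 1, axis 2 1}"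
    "scaleC :: complex \<Rightarrow> 'a \<Rightarrow> 'a" ..
  have "axis 1 1 \<noteq> (axis 2 1 :: complex^2)"
    by (simp add: axis_eq_axis)
  then have dim: "complex_vector.dim (UNIV :: (complex^2) set) = 2"
    using coin.dim_UNIV by simp
  have linT: "Vector_Spaces.linear scaleC scaleC T"
    using T_lin by unfold_locales (simp_all add: complex_vector.scale_right_distrib)
  have injT: "inj T"
    by (metis RT injI)

  \<comment> \<open>Since \<open>T\<close> is onto \<open>K\<close>, the image of the new block is
    \<open>R\<close> of the old image, and the injective \<open>T\<close> maps it back; so the
    dimensions agree. The finite spanning sets then select the finite case of \<open>rank_on\<close>
    on both sides.\<close>
  have "edge_count coin_space U' m n = edge_count H U m n" for m n
  proof -
    let ?X = "block U m n ` K"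
    have X: "?X \<subseteq> K"
      using block_in[OF U sub] HK by auto
    have "block U' m n ` UNIV = R ` ?X"
      unfolding block' T_range[symmetric] by auto
    moreover have "T ` R ` ?X = ?X"
      using X TR by (force simp: image_image)
    then have "complex_vector.dim ?X = complex_vector.dim (R ` ?X)"
      using pair.dim_image_eq[OF linT, of "R ` ?X"] injT inj_on_subset by (metis subset_UNIV)
    moreover have "\<exists>B. finite B \<and> R ` ?X \<subseteq> complex_vector.span B"
      using coin.span_Basis by (intro exI[of _ "{axis 1 1, axis 2 1}"]) auto
    moreover have "\<exists>B. finite B \<and> ?X \<subseteq> complex_vector.span B"
      using X orthonormal_basis2_span[OF onb] by (intro exI[of _ "{v, w}"]) auto
    ultimately show ?thesis
      by (simp add: edge_count_def rank_on_def HK)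
  qed
  moreover have "separable_space (top_of_set (UNIV :: (complex^2) set))"
  proof -
    obtain \<B> :: "(complex^2) set set" where "countable \<B>" "topological_basis \<B>"
      using ex_countable_basis by blast
    then have "second_countable (euclidean :: (complex^2) topology)"
      unfolding second_countable_def
      by (intro exI[of _ \<B>]) (simp, meson topological_basis_open topological_basisE)
    then show ?thesis
      by (simp add: second_countable_imp_separable_space)
  qed
  then have "quantum_walk UNIV coin_space U'"
    using U' by (simp add: quantum_walk_def hilbert_subspace_def complete_UNIV
        complex_vector.subspace_UNIV)
  ultimately have "one_dimensional_qw coin_space U'"
    using dim edges by (simp add: one_dimensional_qw_def)
  moreover have "translation_invariant coin_space U'"
    using trans T_in unfolding translation_invariant_def block' HK by metis
  moreover have "unitary_equivalent UNIV coin_space U' UNIV H U"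
    unfolding unitary_equivalent_def
  proof (intro exI[of _ W] exI[of _ id] conjI ballI)
    show "W ` (single n ` UNIV) = single (id n) ` H (id n)" for n
      unfolding HK T_range[symmetric] by (simp add: image_image W_single)
    fix g
    assume "g \<in> dsum UNIV H"
    moreover have "W ` dsum UNIV coin_space = dsum UNIV H"
      using W by (simp add: dsum_unitary_def bij_betw_def)
    ultimately obtain f where f: "f \<in> dsum UNIV coin_space" "g = W f"
      by blast
    \<comment> \<open>The adjoint takes \<open>g = W f\<close> back to \<open>f\<close>, so
      \<open>W (U' f) = U g\<close> is what remains. There \<open>T\<close> undoes \<open>R\<close>
      because \<open>U g\<close> has its values in \<open>K\<close>.\<close>
    have "U g \<in> dsum UNIV H"
      using U \<open>g \<in> dsum UNIV H\<close> by (auto simp: dsum_unitary_def bij_betw_def)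
    then have "W (U' f) = U g"
      unfolding W_def U'_def f(2)[symmetric] f(2)[unfolded W_def, symmetric]
      by (auto simp: TR dsum_def HK)
    then show "W (U' (dsum_adjoint UNIV coin_space UNIV W g)) = U g"
      using dsum_adjoint_unitary[OF _ W f(1)] f(2) by (simp add: complex_vector.subspace_UNIV)
  qed (use W in auto)
  moreover have "block U' (n + m) n x = mat2 (e m v v) (e m v w) (e m w v) (e m w w) *v x"
    for m n x
  proof -
    have "block U (n + m) n (T x) = block U m 0 (T x)"
      using translation_invariant_block(2)[OF trans, of "T x" m n] T_in
      by (simp add: K_def add.commute)
    also have "\<dots> = (x $ 1) *\<^sub>C block U m 0 v + (x $ 2) *\<^sub>C block U m 0 w"
      unfolding T_def using K by (intro block_linear[OF U sub]) (simp_all add: HK)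
    finally show ?thesis
      unfolding block' e_def
      by (simp add: R_def mat2_mult_vector cinner_linear_simps mult.commute)
  qed
  ultimately show ?thesis
    by blast
qed

section \<open>Class membership and the consequences of unitarity\<close>

lemma walk_classI:
  assumes "one_dimensional_qw coin_space U"
    and "\<And>n x. block U (n - 1) n x = L a b c d *v x"
    and "\<And>n x. block U (n + 1) n x = R a b c d *v x"
  shows "U \<in> walk_class L R"
  \<comment> \<open>The same two matrices occur at every vertex, so constant sequences serve as the
    entries.\<close>
  using assms by (auto simp: walk_class_def component_eq ketbra_def intro!: exI[of _ "\<lambda>_. _"])

text \<open>
  The first identity is the diagonal part of \<open>U\<^sup>*U = 1\<close>; the second one is the entry of
  \<open>U\<^sup>*U\<close> between the vertices \<open>0\<close> and \<open>2\<close>, which communicate only through the vertex \<open>1\<close>.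
\<close>

lemma block_relations:
  assumes walk: "one_dimensional_qw H U" and trans: "translation_invariant H U"
    and x: "x \<in> H 0" and y: "y \<in> H 0"
  shows "cinner (block U (-1) 0 x) (block U (-1) 0 y) + cinner (block U 1 0 x) (block U 1 0 y) =
      cinner x y"
    and "cinner (block U 1 0 x) (block U (-1) 0 y) = 0"
proof -
  have U: "dsum_unitary UNIV H UNIV H U" and sub: "complex_vector.subspace (H n)"
    and edges: "edge_count H U m n = (if \<bar>m - n\<bar> = 1 then 1 else 0)" for m n
    using walk by (auto simp: one_dimensional_qw_def quantum_walk_def hilbert_subspace_def)
  have H: "H n = H 0" for n
    by (rule translation_invariant_block(1)[OF trans])
  have iso: "dsum_inner UNIV (U (single m z)) (U (single n z')) = cinner z (single n z' m)"
    if "z \<in> H 0" "z' \<in> H 0" for m n z z'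
  proof -
    have "single k u \<in> dsum UNIV H" if "u \<in> H 0" for k u
      using single_in_dsum[of H u k] sub that H by auto
    then show ?thesis
      using U that by (simp add: dsum_unitary_def dsum_inner_single_left)
  qed
  have zero: "U (single n z) m = 0" if "\<bar>m - n\<bar> \<noteq> 1" "z \<in> H 0" for m n z
    using edge_count_0_block[of H U m n z] edges that H[of n] by (simp add: block_eq)
  have "dsum_inner UNIV (U (single 0 x)) (U (single 0 y)) =
      (\<Sum>\<^sub>\<infinity>m\<in>{-1, 1}. cinner (U (single 0 x) m) (U (single 0 y) m))"
    unfolding dsum_inner_def using x y by (intro infsum_cong_neutral) (auto simp: zero)
  then show "cinner (block U (-1) 0 x) (block U (-1) 0 y) +
      cinner (block U 1 0 x) (block U 1 0 y) = cinner x y"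
    using iso[OF x y, of 0 0] by (simp add: block_eq single_def)
  have "dsum_inner UNIV (U (single 0 x)) (U (single 2 y)) =
      (\<Sum>\<^sub>\<infinity>m\<in>{1}. cinner (U (single 0 x) m) (U (single 2 y) m))"
    unfolding dsum_inner_def
  proof (intro infsum_cong_neutral)
    fix m :: int
    assume "m \<in> UNIV - {1}"
    then have "\<bar>m - 0\<bar> \<noteq> 1 \<or> \<bar>m - 2\<bar> \<noteq> 1"
      by auto
    then show "cinner (U (single 0 x) m) (U (single 2 y) m) = 0"
      using zero x y by (metis cinner_zero_left cinner_zero_right)
  qed auto
  \<comment> \<open>The block from \<open>2\<close> to \<open>1\<close> is a translate of the one
    from \<open>0\<close> to \<open>-1\<close>, which turns the entry between \<open>0\<close> and
    \<open>2\<close> into a relation between blocks leaving \<open>0\<close>.\<close>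
  moreover have "U (single 2 y) 1 = U (single 0 y) (-1)"
    using translation_invariant_block(2)[OF trans y, of "-1" 2] by (simp add: block_eq)
  ultimately show "cinner (block U 1 0 x) (block U (-1) 0 y) = 0"
    using iso[OF x y, of 0 2] by (simp add: block_eq single_def)
qed

section \<open>Adapted bases and the four classes\<close>

theorem corollary5p2:
  fixes H :: "int \<Rightarrow> 'a::complex_inner set"
    and U :: "(int \<Rightarrow> 'a) \<Rightarrow> (int \<Rightarrow> 'a)"
  assumes "one_dimensional_qw H U"
    and "translation_invariant H U"
  shows "\<forall>C\<in>{class1, class2, class3, class4}. \<exists>U'\<in>C.
    translation_invariant coin_space U' \<and> unitary_equivalent UNIV coin_space U' UNIV H U"
proof -
  define A where "A = block U (-1) 0"
  define B where "B = block U 1 0"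
  have U: "dsum_unitary UNIV H UNIV H U"
    and sub: "complex_vector.subspace (H n)" and dim: "complex_vector.dim (H n) = 2"
    and edges: "edge_count H U m n = (if \<bar>m - n\<bar> = 1 then 1 else 0)" for m n
    using assms(1) by (auto simp: one_dimensional_qw_def quantum_walk_def hilbert_subspace_def)
  note rel = block_relations[OF assms, folded A_def B_def]
  note AB_lin = block_linear[OF U sub, of _ 0 _ "-1", folded A_def]
    block_linear[OF U sub, of _ 0 _ 1, folded B_def]
  have AB_in: "A x \<in> H 0" "B x \<in> H 0" if "x \<in> H 0" for x
    using block_in[OF U sub that] translation_invariant_block(1)[OF assms(2)]
    unfolding A_def B_def by blast+
  have e: "edge_count H U (-1) 0 = 1" "edge_count H U 1 0 = 1"
    by (simp_all add: edges)
  note A1 = edge_count_1_block[OF e(1), folded A_def]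
    and B1 = edge_count_1_block[OF e(2), folded B_def]

  \<comment> \<open>\<open>v\<close> is a normalised value of \<open>A\<close> and \<open>w\<close>
    one of \<open>B\<close>. The second relation makes all values of \<open>A\<close> orthogonal to
    all values of \<open>B\<close>, hence to \<open>w\<close>, and vice versa.\<close>
  obtain v w where vw: "orthonormal_basis2 (H 0) v w"
    and cod: "\<And>x. x \<in> H 0 \<Longrightarrow> cinner w (A x) = 0" "\<And>x. x \<in> H 0 \<Longrightarrow> cinner v (B x) = 0"
  proof -
    obtain x y where xy: "x \<in> H 0" "A x \<noteq> 0" "y \<in> H 0" "B y \<noteq> 0"
      using A1 B1 by auto
    have BA: "cinner (B y') (A x') = 0" "cinner (A x') (B y') = 0"
      if "x' \<in> H 0" "y' \<in> H 0" for x' y'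
      using rel(2)[of y' x'] cinner_commute[of "A x'" "B y'"] that by auto
    obtain a b where "orthonormal_basis2 (H 0) (a *\<^sub>C A x) (b *\<^sub>C B y)"
      using orthonormal_basis2_exists[OF sub dim AB_in(1)[OF xy(1)] AB_in(2)[OF xy(3)]] xy BA
      by auto
    then show thesis
      using xy BA by (intro that[of "a *\<^sub>C A x" "b *\<^sub>C B y"]) (simp_all add: cinner_scaleC_left)
  qed
  obtain p q where pq: "orthonormal_basis2 (H 0) p q" and ker: "A q = 0" "B p = 0"
  proof -
    obtain x y where xy: "x \<in> H 0" "x \<noteq> 0" "A x = 0" "y \<in> H 0" "y \<noteq> 0" "B y = 0"
      using exists_kernel_vector[OF sub dim AB_lin(1)] exists_kernel_vector[OF sub dim AB_lin(2)]
        A1(1) B1(1) by metis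
    \<comment> \<open>In the first relation at \<open>y\<close> and \<open>x\<close> both summands
      vanish, one by \<open>A x = 0\<close> and the other by \<open>B y = 0\<close>.\<close>
    then have "cinner y x = 0"
      using rel(1)[of y x] by simp
    then obtain a b where "orthonormal_basis2 (H 0) (a *\<^sub>C y) (b *\<^sub>C x)"
      using orthonormal_basis2_exists[OF sub dim] xy by blast
    then show thesis
      using xy AB_lin(1)[of x x b 0] AB_lin(2)[of y y a 0] that by auto
  qed
  \<comment> \<open>Membership reduces to matching the shapes \<open>L\<close> and \<open>R\<close>
    with the matrices of \<open>A\<close> and \<open>B\<close> in an orthonormal basis
    \<open>s\<close>, \<open>t\<close>.\<close>
  have in_class: "\<exists>U'\<in>walk_class L R. translation_invariant coin_space U' \<and>
      unitary_equivalent UNIV coin_space U' UNIV H U"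
    if "orthonormal_basis2 (H 0) s t"
      and L: "L a b c d =
        mat2 (cinner s (A s)) (cinner s (A t)) (cinner t (A s)) (cinner t (A t))"
      and R: "R a b c d =
        mat2 (cinner s (B s)) (cinner s (B t)) (cinner t (B s)) (cinner t (B t))"
    for s t L R a b c d
  proof -
    obtain U' where U': "one_dimensional_qw coin_space U'" "translation_invariant coin_space U'"
        "unitary_equivalent UNIV coin_space U' UNIV H U"
      and block': "\<And>m n x. block U' (n + m) n x =
        mat2 (cinner s (block U m 0 s)) (cinner s (block U m 0 t))
          (cinner t (block U m 0 s)) (cinner t (block U m 0 t)) *v x"
      using change_of_basis[OF assms \<open>orthonormal_basis2 (H 0) s t\<close>] by blast
    have "U' \<in> walk_class L R"
      using block'[of _ "-1"] block'[of _ 1]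
      by (intro walk_classI[where a = a and b = b and c = c and d = d] U'(1))
        (simp_all add: L R A_def B_def)
    then show ?thesis
      using U' by blast
  qed
  have in_H: "v \<in> H 0" "w \<in> H 0" "p \<in> H 0" "q \<in> H 0"
    using vw pq by (auto simp: orthonormal_basis2_def)
  have "\<exists>U'\<in>class1. translation_invariant coin_space U' \<and>
      unitary_equivalent UNIV coin_space U' UNIV H U"
    unfolding class1_def
    \<comment> \<open>The range of \<open>A\<close> lies on \<open>v\<close> and that of
      \<open>B\<close> on \<open>w\<close>: only the first row of \<open>A\<close> and the second
      row of \<open>B\<close> survive.\<close>
    by (rule in_class[OF vw,
          where a = "cinner v (A v)" and b = "cinner v (A w)"
            and c = "cinner w (B v)" and d = "cinner w (B w)"])
      (simp_all add: cod in_H)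
  moreover have "\<exists>U'\<in>class2. translation_invariant coin_space U' \<and>
      unitary_equivalent UNIV coin_space U' UNIV H U"
    unfolding class2_def
    \<comment> \<open>As \<open>A q = 0\<close> and \<open>B p = 0\<close>, only the first column of
      \<open>A\<close> and the second column of \<open>B\<close> survive.\<close>
    by (rule in_class[OF pq,
          where a = "cinner p (A p)" and b = "cinner p (B q)"
            and c = "cinner q (A p)" and d = "cinner q (B q)"])
      (simp_all add: ker)
  moreover have "\<exists>U'\<in>class3. translation_invariant coin_space U' \<and>
      unitary_equivalent UNIV coin_space U' UNIV H U"
    unfolding class3_def
    \<comment> \<open>With \<open>w\<close> first, the rows are exchanged: \<open>A\<close> fills
      the second and \<open>B\<close> the first.\<close>
    by (rule in_class[OF orthonormal_basis2_commute[OF vw],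
          where a = "cinner w (B w)" and b = "cinner w (B v)"
            and c = "cinner v (A w)" and d = "cinner v (A v)"])
      (simp_all add: cod in_H)
  moreover have "\<exists>U'\<in>class4. translation_invariant coin_space U' \<and>
      unitary_equivalent UNIV coin_space U' UNIV H U"
    unfolding class4_def
    \<comment> \<open>With \<open>q\<close> first, the columns are exchanged: \<open>A\<close> fills
      the second and \<open>B\<close> the first.\<close>
    by (rule in_class[OF orthonormal_basis2_commute[OF pq],
          where a = "cinner q (B q)" and b = "cinner q (A p)"
            and c = "cinner p (B q)" and d = "cinner p (A p)"])
      (simp_all add: ker)
  ultimately show ?thesis
    by blast
qed

end
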